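(* Let $A$ be the discrete Laplacian of the C60 fullerene buckyball, with eigenvalues $0=\lambda_0<\lambda_1\le\cdots\le\lambda_{59}$ counted with multiplicity, let $E$ be its Sobolev energy, and let $G_*$ be the pseudo Green matrix of $A$. There exists a constant $C>0$ such that for every $u={}^t(u(0),\dots,u(59))\in\mathbb{C}^{60}$ satisfying $u(0)+\cdots+u(59)=0$, the discrete Sobolev inequality $$\left(\max_{0\le j\le 59}|u(j)|\right)^2\le C\,E(u)$$ holds (with $C$ independent of $u$). Among all such $C$, the best (smallest) constant is $$C_0=\frac{239741}{376200}.$$ All the diagonal entries of $G_*$ are equal to $C_0$; in particular $$C_0=\frac{1}{60}\sum_{j=1}^{59}\frac{1}{\lambda_j}.$$ If $C$ is replaced by $C_0$ in the discrete Sobolev inequality $\left(\max_{0\le j\le 59}|u(j)|\right)^2\le C\,E(u)$, then equality holds for every column vector $u$ of $G_*$.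
   Context: The C60 fullerene buckyball is the graph of the truncated icosahedron (60 vertices, 90 edges, 12 pentagonal and 20 hexagonal faces; every vertex has degree 3). Concretely, its vertices are the ordered pairs $(v,w)$ of adjacent vertices of the icosahedron graph; $(v,w)$ is adjacent to $(w,v)$, and $(v,w)$ is adjacent to $(v,w')$ whenever $w,w'$ are adjacent in the icosahedron graph; there are no other edges. The 60 vertices are labeled by the integers $0,1,\dots,59$, and $e$ denotes the set of (undirected) edges, each edge counted once. The discrete Laplacian is the $60\times 60$ real symmetric positive-semidefinite matrix $A=(a(i,j))_{0\le i,j\le 59}$ with $a(i,j)=3$ if $i=j$, $a(i,j)=-1$ if $(i,j)\in e$, and $a(i,j)=0$ otherwise. Its eigenvalue $0$ is simple with eigenvector $\mathbf{1}={}^t(1,\dots,1)\in\mathbb{C}^{60}$. For $u={}^t(u(0),\dots,u(59))\in\mathbb{C}^{60}$ the Sobolev energy is $E(u)=\sum_{(i,j)\in e}|u(i)-u(j)|^2=u^*Au$. Let $E_0=\frac{1}{60}\mathbf{1}\,{}^t\mathbf{1}$ be the orthogonal projection matrix onto the eigenspace of $A$ for the eigenvalue $0$, and let $I$ be the identity matrix. The pseudo Green matrix $G_*$ is the unique $60\times 60$ matrix satisfying $AG_*=G_*A=I-E_0$ and $G_*E_0=E_0G_*=O$ (the zero matrix); it is the Moore–Penrose generalized inverse of $A$. *)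

theory Defs
  imports Complex_Main "Jordan_Normal_Form.Char_Poly"
begin

(* The icosahedron graph as a pentagonal antiprism (rings 1..5 and 6..10, indexed by k mod 5)
   with two apexes 0 and 11. *)

definition ico_edges :: "nat set set" where
  "ico_edges = (\<Union>k\<in>{0..<5}.
     {{0, 1 + k}, {1 + k, 1 + (k + 1) mod 5},
      {1 + k, 6 + k}, {1 + k, 6 + (k + 1) mod 5},
      {6 + k, 6 + (k + 1) mod 5}, {6 + k, 11}})"

definition ico_adj :: "nat \<Rightarrow> nat \<Rightarrow> bool" where
  "ico_adj v w \<longleftrightarrow> {v, w} \<in> ico_edges"

definition bucky_vertices :: "(nat \<times> nat) set" where
  "bucky_vertices = {(v, w). ico_adj v w}"

definition bucky_adj :: "nat \<times> nat \<Rightarrow> nat \<times> nat \<Rightarrow> bool" where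
  "bucky_adj p q \<longleftrightarrow> p \<in> bucky_vertices \<and> q \<in> bucky_vertices \<and>
     (q = (snd p, fst p) \<or> (fst q = fst p \<and> ico_adj (snd p) (snd q)))"

definition bucky_labeling :: "(nat \<Rightarrow> nat \<times> nat) \<Rightarrow> bool" where
  "bucky_labeling lab \<longleftrightarrow> bij_betw lab {0..<60} bucky_vertices"

(* Each undirected edge is represented once, by its pair of labels in increasing order. *)

definition bucky_edges :: "(nat \<Rightarrow> nat \<times> nat) \<Rightarrow> (nat \<times> nat) set" where
  "bucky_edges lab = {(i, j). i < j \<and> j < 60 \<and> bucky_adj (lab i) (lab j)}"

definition laplacian :: "(nat \<Rightarrow> nat \<times> nat) \<Rightarrow> real mat" where
  "laplacian lab = mat 60 60 (\<lambda>(i, j).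
     if i = j then 3
     else if (i, j) \<in> bucky_edges lab \<or> (j, i) \<in> bucky_edges lab then -1
     else 0)"

definition sobolev_energy :: "(nat \<Rightarrow> nat \<times> nat) \<Rightarrow> complex vec \<Rightarrow> real" where
  "sobolev_energy lab u = (\<Sum>(i, j)\<in>bucky_edges lab. (cmod (u $ i - u $ j))\<^sup>2)"

definition max_abs :: "complex vec \<Rightarrow> real" where
  "max_abs u = (MAX j\<in>{0..<60}. cmod (u $ j))"

definition sobolev_inequality :: "(nat \<Rightarrow> nat \<times> nat) \<Rightarrow> real \<Rightarrow> bool" where
  "sobolev_inequality lab C \<longleftrightarrow>
     (\<forall>u\<in>carrier_vec 60. (\<Sum>j = 0..<60. u $ j) = 0 \<longrightarrow>
        (max_abs u)\<^sup>2 \<le> C * sobolev_energy lab u)"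

(* The real roots of the characteristic polynomial with their algebraic multiplicities,
   in increasing order. There are dim_row A of them when A is symmetric. *)

definition eigenvalue_list :: "real mat \<Rightarrow> real list" where
  "eigenvalue_list A = sorted_list_of_multiset (proots (char_poly A))"

definition E0_mat :: "real mat" where
  "E0_mat = mat 60 60 (\<lambda>_. 1 / 60)"

definition is_pseudo_green :: "real mat \<Rightarrow> real mat \<Rightarrow> bool" where
  "is_pseudo_green A G \<longleftrightarrow> G \<in> carrier_mat 60 60 \<and>
     A * G = 1\<^sub>m 60 - E0_mat \<and> G * A = 1\<^sub>m 60 - E0_mat \<and>
     G * E0_mat = 0\<^sub>m 60 60 \<and> E0_mat * G = 0\<^sub>m 60 60"

definition pseudo_green :: "real mat \<Rightarrow> real mat" where
  "pseudo_green A = (THE G. is_pseudo_green A G)"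

end

theory Submission
  imports Defs "HOL-Analysis.Convex" "Jordan_Normal_Form.Schur_Decomposition"
begin

text \<open>The idea is that the pseudo Green matrix \<open>G\<close> is a reproducing kernel. Summation by parts turns
\<open>A * G = 1 - E\<close>, where \<open>E\<close> is the projection onto the constants, into the identity that the
value \<open>u k\<close> of a vector with zero sum is the Dirichlet inner product of \<open>u\<close> with column \<open>k\<close> of \<open>G\<close>
(lemma \<open>green_reproducing\<close>). In particular the energy of column \<open>k\<close> is its own value
\<open>G k k\<close> at \<open>k\<close>. By the Cauchy--Schwarz inequality the square of \<open>\<bar>u k\<bar>\<close> is at most \<open>G k k\<close> times
the energy of \<open>u\<close> (lemma \<open>sobolev_pointwise\<close>). As soon as all diagonal entries of \<open>G\<close> equal one
number \<open>C0\<close>, this is the Sobolev inequality with constant \<open>C0\<close>. Column \<open>k\<close> of \<open>G\<close> has energy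
\<open>C0\<close> and the entry \<open>C0\<close>, so it attains equality, and no smaller constant is possible.

The diagonal entries agree because the rotations of the icosahedron act transitively on the
vertices of the buckyball. Hence a single column of \<open>G\<close> determines the whole matrix. One column
is given explicitly as a table of rational numbers; that it solves the discrete Poisson equation
is a check of sixty integer equations (lemma \<open>green_check\<close>), and two rotations carry it to all
other vertices (lemma \<open>green_col_exists\<close>). The value \<open>C0 = 239741 / 376200\<close> is read off from the
table.

The eigenvalues are real and non-negative, because the quadratic form of \<open>A\<close> is the energy (lemma
\<open>laplacian_complex_eigenvalue\<close>). The formula for \<open>C0\<close> by eigenvalues computes the trace of \<open>G\<close> in
two ways: as \<open>60 * C0\<close> from the diagonal, and as the sum of the reciprocals of the non-zero
eigenvalues from a Schur form of \<open>A\<close> (lemma \<open>trace_pseudo_inverse\<close>).\<close>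

section \<open>The trace of a pseudo inverse\<close>

text \<open>Column \<open>j\<close> of \<open>S * T = 1\<close> involves only the columns \<open>k \<le> j\<close> of \<open>S\<close>. The earlier ones
vanish below their diagonals, so on and below the diagonal only the term with \<open>k = j\<close> survives.
The second conjunct, that \<open>S\<close> is again upper triangular, is what the induction feeds on.\<close>

lemma inverse_upper_triangular_diag:
  fixes S T :: "'a :: field mat"
  assumes S: "S \<in> carrier_mat n n" and T: "T \<in> carrier_mat n n"
    and ST: "S * T = 1\<^sub>m n" and tri: "upper_triangular T" and "j < n"
  shows "S $$ (j, j) * T $$ (j, j) = 1 \<and> (\<forall>i. j < i \<and> i < n \<longrightarrow> S $$ (i, j) = 0)"
  using \<open>j < n\<close>
proof (induction j rule: less_induct)
  case (less j)
  have entry: "S $$ (i, j) * T $$ (j, j) = (if i = j then 1 else 0)" if i: "j \<le> i" "i < n" for i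
  proof -
    have "(S * T) $$ (i, j) = (\<Sum>k<n. S $$ (i, k) * T $$ (k, j))"
      using S T i less.prems by (simp add: scalar_prod_def atLeast0LessThan)
    also have "\<dots> = (\<Sum>k<n. if k = j then S $$ (i, j) * T $$ (j, j) else 0)"
    proof (rule sum.cong[OF refl])
      fix k assume k: "k \<in> {..<n}"
      consider "k < j" | "k = j" | "j < k" by linarith
      then show "S $$ (i, k) * T $$ (k, j) = (if k = j then S $$ (i, j) * T $$ (j, j) else 0)"
      proof cases
        case 1
        then show ?thesis using less.IH[of k] less.prems i by auto
      next
        case 3
        then show ?thesis using tri T k by (auto simp: upper_triangular_def)
      qed auto
    qed
    also have "\<dots> = S $$ (i, j) * T $$ (j, j)"
      using less.prems by simp
    finally show ?thesis
      using ST i less.prems by auto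
  qed
  from entry[of j] have one: "S $$ (j, j) * T $$ (j, j) = 1"
    using less.prems by simp
  then have "T $$ (j, j) \<noteq> 0" by auto
  with entry one show ?case
    by (metis less_imp_le_nat less_irrefl mult_eq_0_iff)
qed

lemma trace_mult_comm:
  fixes A B :: "'a :: comm_semiring_0 mat"
  assumes "A \<in> carrier_mat n m" "B \<in> carrier_mat m n"
  shows "(\<Sum>i<n. (A * B) $$ (i, i)) = (\<Sum>i<m. (B * A) $$ (i, i))"
proof -
  have "(\<Sum>i<n. (A * B) $$ (i, i)) = (\<Sum>i<n. \<Sum>k<m. A $$ (i, k) * B $$ (k, i))"
    using assms by (simp add: scalar_prod_def atLeast0LessThan)
  also have "\<dots> = (\<Sum>k<m. \<Sum>i<n. B $$ (k, i) * A $$ (i, k))"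
    by (subst sum.swap) (simp add: mult.commute)
  also have "\<dots> = (\<Sum>i<m. (B * A) $$ (i, i))"
    using assms by (simp add: scalar_prod_def atLeast0LessThan)
  finally show ?thesis .
qed

lemma conjugate_mult:
  fixes P Q X Y :: "'a :: semiring_1 mat"
  assumes P: "P \<in> carrier_mat n n" and Q: "Q \<in> carrier_mat n n"
    and X: "X \<in> carrier_mat n n" and Y: "Y \<in> carrier_mat n n" and PQ: "P * Q = 1\<^sub>m n"
  shows "(Q * X * P) * (Q * Y * P) = Q * (X * Y) * P"
proof -
  note a = assoc_mult_mat[where ?n\<^sub>1 = n and ?n\<^sub>2 = n and ?n\<^sub>3 = n and ?n\<^sub>4 = n]
  have QX: "Q * X \<in> carrier_mat n n" and QY: "Q * Y \<in> carrier_mat n n"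
    and YP: "Y * P \<in> carrier_mat n n" and XY: "X * Y \<in> carrier_mat n n"
    using P Q X Y by auto
  have "(Q * X * P) * (Q * Y * P) = Q * X * (P * (Q * Y * P))"
    using QX QY P by (intro a) auto
  also have "P * (Q * Y * P) = P * Q * (Y * P)"
    using P Q Y YP by (simp add: a)
  also have "\<dots> = Y * P"
    unfolding PQ by (rule left_mult_one_mat[OF YP])
  also have "Q * X * (Y * P) = Q * X * Y * P"
    using QX Y P by (simp add: a)
  also have "\<dots> = Q * (X * Y) * P"
    using Q X Y by (simp add: a)
  finally show ?thesis .
qed

text \<open>The non-zero eigenvalues of \<open>A\<close> are inverted by the pseudo inverse \<open>G\<close>. Adding to both matrices
the projection \<open>E\<close> onto the constants replaces the eigenvalue \<open>0\<close> by \<open>1\<close> and makes them honest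
inverses of each other. If the Schur form of \<open>A\<close> is taken with the eigenvalue \<open>0\<close> in the first
place, its first basis vector spans the kernel of \<open>A\<close>, that is, it is constant; in this basis
\<open>E\<close> lives in the first row only, and \<open>A + E\<close> stays upper triangular. So the diagonal of its
inverse consists of the reciprocals of \<open>1\<close> and of the non-zero eigenvalues.\<close>

lemma trace_pseudo_inverse:
  fixes A G E :: "real mat"
  assumes E_def: "E = mat n n (\<lambda>_. 1 / real n)"
    and A: "A \<in> carrier_mat n n" and G: "G \<in> carrier_mat n n"
    and GA: "G * A = 1\<^sub>m n - E" and EA: "E * A = 0\<^sub>m n n" and GE: "G * E = 0\<^sub>m n n"
    and cp: "char_poly A = (\<Prod>e\<leftarrow>0 # es. [:- e, 1:])"
  shows "0 \<notin> set es" "(\<Sum>i<n. G $$ (i, i)) = (\<Sum>e\<leftarrow>es. 1 / e)"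
proof -
  have E: "E \<in> carrier_mat n n" by (simp add: E_def)
  obtain B P Q where "schur_decomposition A (0 # es) = (B, P, Q)"
    by (metis prod_cases3)
  from schur_decomposition[OF A cp this]
  have sim: "similar_mat_wit A B P Q" and tri: "upper_triangular B" and dB: "diag_mat B = 0 # es"
    by auto
  note w = similar_mat_witD[OF carrier_matD(1)[OF A, symmetric] sim]
  note PQ = w(1) and QP = w(2) and dec = w(3)
    and B = w(5) and P = w(6) and Q = w(7)
  have n: "n = Suc (length es)"
    using arg_cong[OF dB, of length] B by (simp add: diag_mat_def)
  have npos: "0 < n" using n by simp
  have Bd: "B $$ (i, i) = (0 # es) ! i" if "i < n" for i
    using arg_cong[OF dB, of "\<lambda>l. l ! i"] B that by (simp add: diag_mat_def)
  have AP: "A * P = P * B"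
  proof -
    have "A * P = P * B * (Q * P)" unfolding dec using P Q B by (simp add: assoc_mult_mat[of _ n n _ n _ n])
    then show ?thesis using P B QP by (simp)
  qed
  \<comment> \<open>The first column of \<open>P\<close> lies in the kernel of \<open>A\<close>, hence it is the constant vector \<open>c\<close>.\<close>
  define c where "c = (\<Sum>l<n. P $$ (l, 0)) / n"
  have P0: "P $$ (i, 0) = c" if i: "i < n" for i
  proof -
    have "(P * B) $$ (k, 0) = 0" if "k < n" for k
    proof -
      have "B $$ (l, 0) = 0" if "l < n" for l
        using Bd[of 0] tri B that npos by (cases l) (auto simp: upper_triangular_def)
      then show ?thesis
        using P B npos that by (simp add: scalar_prod_def)
    qed
    then have "(G * (A * P)) $$ (i, 0) = 0"
      unfolding AP using G P B i npos by (simp add: scalar_prod_def)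
    also have "G * (A * P) = P - E * P"
      using G A P E GA by (simp add: assoc_mult_mat[of _ n n _ n _ n, symmetric] minus_mult_distrib_mat[of _ n n])
    finally show ?thesis
      using P E i npos by (simp add: E_def c_def scalar_prod_def atLeast0LessThan sum_divide_distrib)
  qed
  \<comment> \<open>\<open>Q\<close> maps the first column of \<open>P\<close> to the first unit vector, so every other row of \<open>Q\<close> sums to zero.\<close>
  have QP0: "(\<Sum>k<n. Q $$ (i, k)) * c = (if i = 0 then 1 else 0)" if i: "i < n" for i
  proof -
    have "(Q * P) $$ (i, 0) = (\<Sum>k<n. Q $$ (i, k) * c)"
      using Q P i npos P0 by (simp add: scalar_prod_def atLeast0LessThan)
    then show ?thesis
      using QP i npos by (simp add: sum_distrib_right)
  qed
  then have c: "c \<noteq> 0" using npos by (metis mult_zero_right zero_neq_one)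
  \<comment> \<open>The conjugate of \<open>E\<close> is concentrated in its first row, with corner entry \<open>1\<close>.\<close>
  define F where "F = Q * E * P"
  have F: "F \<in> carrier_mat n n" using Q P E by (simp add: F_def)
  have Fij: "F $$ (i, j) = (\<Sum>k<n. Q $$ (i, k)) * ((\<Sum>l<n. P $$ (l, j)) / n)"
    if "i < n" "j < n" for i j
    using that Q P E by (simp add: F_def E_def scalar_prod_def atLeast0LessThan
        sum_distrib_left sum_distrib_right sum_divide_distrib)
  have F0: "F $$ (i, j) = 0" if "0 < i" "i < n" "j < n" for i j
    using QP0[of i] that c Fij[of i j] by simp
  have F00: "F $$ (0, 0) = 1"
    using Fij[of 0 0, folded c_def] QP0[of 0] npos by simp
  define G' where "G' = Q * G * P"
  have G': "G' \<in> carrier_mat n n" using Q P G by (simp add: G'_def)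
  have QAP: "Q * A * P = B"
  proof -
    have "Q * A * P = Q * (P * B)" using Q A P AP by simp
    also have "\<dots> = Q * P * B" using Q P B by simp
    finally show ?thesis using QP B by simp
  qed
  have EE: "E * E = E" using npos by (auto simp: E_def scalar_prod_def)
  have inv: "(G + E) * (A + E) = 1\<^sub>m n"
  proof -
    have "(G + E) * (A + E) = (G * A + E * A) + (G * E + E * E)"
      using G E A by (simp add: add_mult_distrib_mat[of _ n n] mult_add_distrib_mat[of _ n n])
    then show ?thesis unfolding GA GE EA EE using E by auto
  qed
  have S: "G' + F = Q * (G + E) * P" and T: "B + F = Q * (A + E) * P"
    using Q P G E A QAP by (simp_all add: G'_def F_def add_mult_distrib_mat[of _ n n] mult_add_distrib_mat[of _ n n])
  have ST: "(G' + F) * (B + F) = 1\<^sub>m n"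
    unfolding S T using conjugate_mult[OF P Q _ _ PQ, of "G + E" "A + E"] Q P QP G E A inv by simp
  \<comment> \<open>Only the corner of the diagonal of \<open>B\<close> changes: from \<open>0\<close> to \<open>1\<close>.\<close>
  have triT: "upper_triangular (B + F)"
    using tri B F F0 by (auto simp: upper_triangular_def)
  have key: "(G' + F) $$ (i, i) * (B + F) $$ (i, i) = 1" if "i < n" for i
    using inverse_upper_triangular_diag[OF _ _ ST triT that] G' B F by simp
  have G'0: "G' $$ (0, 0) = 0"
    using key[of 0] Bd[of 0] F00 G' B F npos by simp
  have G'S: "G' $$ (Suc i, Suc i) * es ! i = 1" if "i < length es" for i
    using key[of "Suc i"] Bd[of "Suc i"] F0[of "Suc i" "Suc i"] G' B F n that by simp
  then show "0 \<notin> set es"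
    by (metis in_set_conv_nth mult_zero_right zero_neq_one)
  have "(\<Sum>i<n. G $$ (i, i)) = (\<Sum>i<n. (P * Q * G) $$ (i, i))"
    using PQ G by simp
  also have "\<dots> = (\<Sum>i<n. (P * (Q * G)) $$ (i, i))"
    using P Q G by simp
  also have "\<dots> = (\<Sum>i<n. G' $$ (i, i))"
    unfolding G'_def using P Q G by (intro trace_mult_comm) auto
  also have "\<dots> = (\<Sum>i<length es. G' $$ (Suc i, Suc i))"
    unfolding n by (subst sum.lessThan_Suc_shift) (simp add: G'0)
  also have "\<dots> = (\<Sum>i<length es. 1 / es ! i)"
  proof (intro sum.cong refl)
    fix i assume "i \<in> {..<length es}"
    with G'S[of i] show "G' $$ (Suc i, Suc i) = 1 / es ! i"
      by (cases "es ! i = 0") (auto simp: eq_divide_eq)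
  qed
  also have "\<dots> = (\<Sum>e\<leftarrow>es. 1 / e)"
    by (simp add: sum_list_sum_nth atLeast0LessThan)
  finally show "(\<Sum>i<n. G $$ (i, i)) = (\<Sum>e\<leftarrow>es. 1 / e)" .
qed

section \<open>The graph of the buckyball\<close>

text \<open>Adjacency lists of the icosahedron and of the buckyball make both graphs computable. A vertex of
the buckyball is a dart (an oriented edge) of the icosahedron.\<close>

definition ico_nbrs :: "nat list list" where
  "ico_nbrs =
    [[1, 2, 3, 4, 5],
     [0, 2, 7, 6, 5], [0, 1, 7, 8, 3], [0, 2, 8, 9, 4], [0, 3, 9, 10, 5], [0, 1, 6, 10, 4],
     [1, 5, 10, 11, 7], [1, 2, 8, 11, 6], [2, 3, 9, 11, 7], [3, 4, 10, 11, 8], [4, 5, 6, 11, 9],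
     [6, 7, 8, 9, 10]]"

definition darts :: "(nat \<times> nat) list" where
  "darts = concat (map (\<lambda>v. map (Pair v) (ico_nbrs ! v)) [0..<12])"

definition bucky_nbrs :: "nat \<times> nat \<Rightarrow> (nat \<times> nat) list" where
  "bucky_nbrs p = (snd p, fst p) #
     map (Pair (fst p)) (filter (\<lambda>w. w \<in> set (ico_nbrs ! snd p)) (ico_nbrs ! fst p))"

lemma in_darts_iff: "(v, w) \<in> set darts \<longleftrightarrow> v < 12 \<and> w \<in> set (ico_nbrs ! v)"
  unfolding darts_def by auto

lemma bucky_vertices_eq: "bucky_vertices = set darts"
proof -
  have five: "{0..<5} = {0, 1, 2, 3, 4 :: nat}" by auto
  have list: "darts = [(0, 1), (0, 2), (0, 3), (0, 4), (0, 5), (1, 0), (1, 2), (1, 7), (1, 6), (1, 5),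
    (2, 0), (2, 1), (2, 7), (2, 8), (2, 3), (3, 0), (3, 2), (3, 8), (3, 9), (3, 4),
    (4, 0), (4, 3), (4, 9), (4, 10), (4, 5), (5, 0), (5, 1), (5, 6), (5, 10), (5, 4),
    (6, 1), (6, 5), (6, 10), (6, 11), (6, 7), (7, 1), (7, 2), (7, 8), (7, 11), (7, 6),
    (8, 2), (8, 3), (8, 9), (8, 11), (8, 7), (9, 3), (9, 4), (9, 10), (9, 11), (9, 8),
    (10, 4), (10, 5), (10, 6), (10, 11), (10, 9), (11, 6), (11, 7), (11, 8), (11, 9), (11, 10)]"
    by code_simp
  have "ico_adj v w \<longleftrightarrow> (v, w) \<in> set darts" for v w
    unfolding ico_adj_def ico_edges_def list five
    by (simp add: doubleton_eq_iff) (rule iffI; elim disjE conjE; hypsubst; simp)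
  then show ?thesis
    unfolding bucky_vertices_def by auto
qed

lemma distinct_darts: "distinct darts"
  by code_simp

lemma cubic_check: "list_all (\<lambda>p. distinct (bucky_nbrs p) \<and> length (bucky_nbrs p) = 3) darts"
  by code_simp

lemma darts_checks:
  "list_all (\<lambda>p. fst p < 12 \<and> snd p < 12 \<and> fst p \<noteq> snd p \<and> (snd p, fst p) \<in> set darts) darts"
  by code_simp

lemma dartD:
  assumes "(v, w) \<in> set darts"
  shows "v < 12" "w < 12" "v \<noteq> w" "(w, v) \<in> set darts"
  using darts_checks assms by (auto simp: list_all_iff)

lemma ico_adj_iff: "ico_adj v w \<longleftrightarrow> (v, w) \<in> set darts"
  using bucky_vertices_eq by (auto simp: bucky_vertices_def)

lemma bucky_adj_iff:
  assumes "p \<in> bucky_vertices"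
  shows "bucky_adj p q \<longleftrightarrow> q \<in> set (bucky_nbrs p)"
proof -
  obtain v w where p: "p = (v, w)" by fastforce
  obtain a b where q: "q = (a, b)" by fastforce
  have vw: "(v, w) \<in> set darts" using assms p bucky_vertices_eq by simp
  note d = dartD[OF vw]
  show ?thesis
    using vw d unfolding p q bucky_adj_def bucky_vertices_eq bucky_nbrs_def ico_adj_iff
    by (auto simp: in_darts_iff)
qed

lemma bucky_adj_sym: "bucky_adj p q \<Longrightarrow> bucky_adj q p"
  unfolding bucky_adj_def ico_adj_def by (auto simp: insert_commute)

lemma bucky_adj_irrefl: "\<not> bucky_adj p p"
  using dartD(3) unfolding bucky_adj_def bucky_vertices_eq ico_adj_iff
  by (metis prod.collapse prod.inject)

lemma finite_bucky_vertices: "finite bucky_vertices"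
  by (simp add: bucky_vertices_eq)

lemma card_bucky_nbrs:
  assumes "p \<in> bucky_vertices"
  shows "card {q. bucky_adj p q} = 3"
proof -
  have "{q. bucky_adj p q} = set (bucky_nbrs p)"
    using bucky_adj_iff[OF assms] by blast
  moreover have "distinct (bucky_nbrs p)" "length (bucky_nbrs p) = 3"
    using cubic_check assms by (auto simp: list_all_iff bucky_vertices_eq)
  ultimately show ?thesis
    by (simp add: distinct_card)
qed

section \<open>Green columns and their symmetry\<close>

definition bucky_lap :: "(nat \<times> nat \<Rightarrow> 'a :: comm_ring_1) \<Rightarrow> nat \<times> nat \<Rightarrow> 'a" where
  "bucky_lap h p = (\<Sum>q | bucky_adj p q. h p - h q)"

text \<open>The column of the pseudo Green matrix that belongs to the vertex \<open>q\<close>, regarded as a function on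
the vertices themselves, so that it does not depend on their labeling. The value at the
source \<open>q\<close> is recorded along with the Poisson equation, because it is the constant in question.\<close>

definition is_green_col :: "nat \<times> nat \<Rightarrow> (nat \<times> nat \<Rightarrow> real) \<Rightarrow> bool" where
  "is_green_col q h \<longleftrightarrow> sum h bucky_vertices = 0 \<and> h q = 239741 / 376200 \<and>
     (\<forall>p\<in>bucky_vertices. bucky_lap h p = (if p = q then 1 else 0) - 1 / 60)"

text \<open>The solution of the discrete Poisson equation with unit source at the dart \<open>(0, 1)\<close>, compensated
by the constant \<open>1 / 60\<close>, and with vanishing sum. It was found by Gaussian elimination. Row \<open>v\<close> and
column \<open>w\<close> hold its value at the dart \<open>(v, w)\<close> in units of \<open>1 / 752400\<close>, a common denominator;
the entries at pairs that are not darts are zero.\<close>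

definition green_table :: "int list list" where
  "green_table =
    [[0, 479482, 235387, 130972, 130972, 235387, 0, 0, 0, 0, 0, 0],
     [227812, 0, 108247, 0, 0, 108247, 39097, 39097, 0, 0, 0, 0],
     [108247, 70372, 0, 31522, 0, 0, 0, 7162, -8303, 0, 0, 0],
     [39097, 0, 7162, 0, -8303, 0, 0, 0, -36593, -43163, 0, 0],
     [39097, 0, 0, -8303, 0, 7162, 0, 0, 0, -43163, -36593, 0],
     [108247, 70372, 0, 0, 31522, 0, 7162, 0, 0, 0, -8303, 0],
     [0, -17513, 0, 0, 0, -28043, 0, -51053, 0, 0, -61238, -72053],
     [0, -17513, -28043, 0, 0, 0, -51053, 0, -61238, 0, 0, -72053],
     [0, 0, -51053, -61238, 0, 0, 0, -71078, 0, -83528, 0, -88403],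
     [0, 0, 0, -72053, -72053, 0, 0, 0, -88403, 0, -88403, -97088],
     [0, 0, 0, 0, -61238, -51053, -71078, 0, 0, -83528, 0, -88403],
     [0, 0, 0, 0, 0, 0, -91328, -91328, -98063, -101918, -98063, 0]]"

definition green_num :: "nat \<times> nat \<Rightarrow> int" where
  "green_num p = green_table ! fst p ! snd p"

text \<open>The Poisson equation for the table in integers: the source \<open>1\<close> has become \<open>752400\<close>, and the
compensating \<open>1 / 60\<close> has become \<open>12540 = 752400 / 60\<close>.\<close>

lemma green_check:
  "list_all (\<lambda>p. 3 * green_num p - sum_list (map green_num (bucky_nbrs p)) =
     (if p = (0, 1) then 752400 else 0) - 12540) darts"
  by code_simp

lemma green_sum_check: "sum_list (map green_num darts) = 0"
  by code_simp

lemma green_col_base: "is_green_col (0, 1) (\<lambda>p. real_of_int (green_num p) / 752400)"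
proof -
  have "sum green_num bucky_vertices = 0"
    using green_sum_check by (simp add: bucky_vertices_eq distinct_darts sum_list_distinct_conv_sum_set)
  then have "(\<Sum>p\<in>bucky_vertices. real_of_int (green_num p) / 752400) = 0"
    by (simp flip: sum_divide_distrib of_int_sum)
  moreover have "green_num (0, 1) = 479482"
    by code_simp
  moreover have "bucky_lap (\<lambda>p. real_of_int (green_num p) / 752400) p
      = (if p = (0, 1) then 1 else 0) - 1 / 60" if p: "p \<in> bucky_vertices" for p
  proof -
    have nb: "{q. bucky_adj p q} = set (bucky_nbrs p)"
      using bucky_adj_iff[OF p] by blast
    have dist: "distinct (bucky_nbrs p)"
      using cubic_check p by (auto simp: list_all_iff bucky_vertices_eq)
    have "bucky_lap green_num p = 3 * green_num p - sum_list (map green_num (bucky_nbrs p))"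
      using card_bucky_nbrs[OF p] dist
      by (simp add: bucky_lap_def sum_subtractf nb sum_list_distinct_conv_sum_set)
    also have "\<dots> = (if p = (0, 1) then 752400 else 0) - 12540"
      using green_check p by (auto simp: list_all_iff bucky_vertices_eq)
    finally have "bucky_lap green_num p = (if p = (0, 1) then 752400 else 0) - 12540" .
    moreover have "bucky_lap (\<lambda>p. real_of_int (green_num p) / 752400) p
        = real_of_int (bucky_lap green_num p) / 752400"
      by (simp add: bucky_lap_def diff_divide_distrib sum_divide_distrib)
    ultimately show ?thesis
      by (cases "p = (0, 1)") simp_all
  qed
  ultimately show ?thesis
    by (simp add: is_green_col_def)
qed

text \<open>An automorphism of the icosahedron graph acts on the darts as an automorphism of the buckyball, and
the Laplacian commutes with automorphisms. So pulling back a Green column along \<open>\<tau>\<close> moves its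
source from \<open>\<tau> q\<close> to \<open>q\<close>, and keeps the value at the source.\<close>

lemma green_col_transport:
  fixes \<tau> :: "nat \<Rightarrow> nat"
  assumes inj: "inj_on \<tau> {..<12}" and pres: "\<And>v w. (v, w) \<in> set darts \<Longrightarrow> (\<tau> v, \<tau> w) \<in> set darts"
    and h: "is_green_col (map_prod \<tau> \<tau> q) h" and q: "q \<in> bucky_vertices"
  shows "is_green_col q (h \<circ> map_prod \<tau> \<tau>)"
proof -
  let ?V = "bucky_vertices" and ?t = "map_prod \<tau> \<tau>"
  have sub: "?V \<subseteq> {..<12} \<times> {..<12}"
    using dartD by (auto simp: bucky_vertices_eq)
  have inj': "inj_on ?t ?V"
    using map_prod_inj_on[OF inj inj] sub by (rule inj_on_subset)
  have img: "?t p \<in> ?V" if "p \<in> ?V" for p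
    using that pres by (cases p) (auto simp: bucky_vertices_eq)
  have surj: "?t ` ?V = ?V"
    using img by (intro card_subset_eq finite_bucky_vertices) (auto simp: card_image[OF inj'])
  have adj: "bucky_adj (?t p) (?t r)" if "bucky_adj p r" for p r
    using that img pres unfolding bucky_adj_def ico_adj_iff by (cases p; cases r) auto
  \<comment> \<open>Neighbours go to neighbours, and both neighbourhoods have three elements.\<close>
  have nbrs: "?t ` {r. bucky_adj p r} = {r. bucky_adj (?t p) r}" if p: "p \<in> ?V" for p
  proof (rule card_subset_eq)
    show "finite {r. bucky_adj (?t p) r}"
      using finite_bucky_vertices by (rule finite_subset[rotated]) (auto simp: bucky_adj_def)
    have "inj_on ?t {r. bucky_adj p r}"
      using inj' by (rule inj_on_subset) (auto simp: bucky_adj_def)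
    then show "card (?t ` {r. bucky_adj p r}) = card {r. bucky_adj (?t p) r}"
      by (simp add: card_image card_bucky_nbrs p img)
    show "?t ` {r. bucky_adj p r} \<subseteq> {r. bucky_adj (?t p) r}"
      by (rule image_subsetI) (rule CollectI, drule CollectD, erule adj)
  qed
  have "bucky_lap (h \<circ> ?t) p = (if p = q then 1 else 0) - 1 / 60" if p: "p \<in> ?V" for p
  proof -
    have "inj_on ?t {r. bucky_adj p r}"
      using inj' by (rule inj_on_subset) (auto simp: bucky_adj_def)
    then have "bucky_lap (h \<circ> ?t) p = bucky_lap h (?t p)"
      unfolding bucky_lap_def by (subst nbrs[OF p, symmetric]) (simp add: sum.reindex)
    also have "\<dots> = (if ?t p = ?t q then 1 else 0) - 1 / 60"
      using h img[OF p] by (simp add: is_green_col_def)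
    finally show ?thesis
      using inj_on_eq_iff[OF inj' p q] by simp
  qed
  moreover have "sum (h \<circ> ?t) ?V = sum h ?V"
    by (subst (2) surj[symmetric]) (simp add: sum.reindex[OF inj'])
  ultimately show ?thesis
    using h by (simp add: is_green_col_def)
qed

text \<open>Two rotations of the icosahedron, as lists of images: the fivefold rotation about the axis through
the apexes \<open>0\<close> and \<open>11\<close>, and the half turn about the axis through the midpoint of the edge
between \<open>0\<close> and \<open>1\<close>.\<close>

definition rot5 :: "nat list" where
  "rot5 = [0, 2, 3, 4, 5, 1, 7, 8, 9, 10, 6, 11]"

definition flip2 :: "nat list" where
  "flip2 = [1, 0, 5, 6, 7, 2, 3, 4, 10, 11, 8, 9]"

lemma automorphism_checks:
  "distinct \<tau> \<and> length \<tau> = 12 \<and> list_all (\<lambda>p. (\<tau> ! fst p, \<tau> ! snd p) \<in> set darts) darts"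
  if "\<tau> \<in> {rot5, flip2}"
proof -
  have "distinct rot5 \<and> length rot5 = 12 \<and>
      list_all (\<lambda>p. (rot5 ! fst p, rot5 ! snd p) \<in> set darts) darts"
    by code_simp
  moreover have "distinct flip2 \<and> length flip2 = 12 \<and>
      list_all (\<lambda>p. (flip2 ! fst p, flip2 ! snd p) \<in> set darts) darts"
    by code_simp
  ultimately show ?thesis using that by blast
qed

text \<open>The two rotations act transitively on the darts: the fivefold rotation permutes the darts that
start at \<open>0\<close>, and together with the half turn it connects \<open>0\<close> to all other vertices of the
icosahedron. So the one explicit Green column yields all of them.\<close>

lemma green_col_exists:
  assumes "q \<in> bucky_vertices"
  shows "\<exists>h. is_green_col q h"
proof -
  define P where "P q \<longleftrightarrow> (\<exists>h. is_green_col q h)" for q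
  have step: "P (v, w)" if "\<tau> \<in> {rot5, flip2}" "P (\<tau> ! v, \<tau> ! w)" "(v, w) \<in> set darts" for \<tau> v w
  proof -
    note c = automorphism_checks[OF that(1)]
    from that(2) obtain h where "is_green_col (\<tau> ! v, \<tau> ! w) h" by (auto simp: P_def)
    then have "is_green_col (v, w) (h \<circ> map_prod ((!) \<tau>) ((!) \<tau>))"
      using c that(3)
      by (intro green_col_transport) (auto simp: bucky_vertices_eq list_all_iff inj_on_def nth_eq_iff_index_eq)
    then show ?thesis by (auto simp: P_def)
  qed
  have mem: "(0, 5) \<in> set darts" "(0, 4) \<in> set darts" "(0, 3) \<in> set darts" "(0, 2) \<in> set darts"
    by (simp_all add: in_darts_iff ico_nbrs_def)
  have P1: "P (0, 1)" using green_col_base by (auto simp: P_def)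
  have P5: "P (0, 5)" using step[of rot5 0 5] P1 mem by (simp add: rot5_def)
  have P4: "P (0, 4)" using step[of rot5 0 4] P5 mem by (simp add: rot5_def)
  have P3: "P (0, 3)" using step[of rot5 0 3] P4 mem by (simp add: rot5_def)
  have P2: "P (0, 2)" using step[of rot5 0 2] P3 mem by (simp add: rot5_def)
  \<comment> \<open>A rotation carries the darts that start at \<open>v\<close> to darts that start at the image of \<open>v\<close>, so from here on it suffices to move vertices of the icosahedron.\<close>
  define Q where "Q v \<longleftrightarrow> (\<forall>w. (v, w) \<in> set darts \<longrightarrow> P (v, w))" for v
  have move: "Q v" if "\<tau> \<in> {rot5, flip2}" "Q (\<tau> ! v)" for \<tau> v
    using step[OF that(1)] that(2) automorphism_checks[OF that(1)]
    by (fastforce simp: Q_def list_all_iff)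
  have Q0: "Q 0" using P1 P2 P3 P4 P5 by (auto simp: Q_def in_darts_iff ico_nbrs_def)
  have Q1: "Q 1" using move[of flip2 1] Q0 by (simp add: flip2_def)
  have Q5: "Q 5" using move[of rot5 5] Q1 by (simp add: rot5_def)
  have Q4: "Q 4" using move[of rot5 4] Q5 by (simp add: rot5_def)
  have Q3: "Q 3" using move[of rot5 3] Q4 by (simp add: rot5_def)
  have Q2: "Q 2" using move[of rot5 2] Q3 by (simp add: rot5_def)
  have Q6: "Q 6" using move[of flip2 6] Q3 by (simp add: flip2_def)
  have Q10: "Q 10" using move[of rot5 10] Q6 by (simp add: rot5_def)
  have Q9: "Q 9" using move[of rot5 9] Q10 by (simp add: rot5_def)
  have Q8: "Q 8" using move[of rot5 8] Q9 by (simp add: rot5_def)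
  have Q7: "Q 7" using move[of rot5 7] Q8 by (simp add: rot5_def)
  have Q11: "Q 11" using move[of flip2 11] Q9 by (simp add: flip2_def)
  obtain v w where q: "q = (v, w)" "(v, w) \<in> set darts"
    using assms by (cases q) (auto simp: bucky_vertices_eq)
  have "v \<in> {0,1,2,3,4,5,6,7,8,9,10,11}"
    using dartD(1)[OF q(2)] by simp presburger
  then have "Q v"
    using Q0 Q1 Q2 Q3 Q4 Q5 Q6 Q7 Q8 Q9 Q10 Q11 by blast
  then show ?thesis
    using q by (simp add: Q_def P_def)
qed

section \<open>The Laplacian and its Dirichlet form\<close>

text \<open>Summation by parts on a graph. Every edge contributes to the left-hand side once from each of its
ends, with \<open>y i * (x i - x j)\<close> and \<open>y j * (x j - x i)\<close>. The form is bilinear rather than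
sesquilinear, so that the same identity serves for real and complex vectors, with a conjugate put
into \<open>y\<close> where it is wanted.\<close>

lemma dirichlet_form:
  fixes x y :: "nat \<Rightarrow> 'a :: comm_ring_1"
  assumes sym: "\<And>i j. R i j \<Longrightarrow> R j i"
  shows "(\<Sum>i<n. y i * (\<Sum>j | j < n \<and> R i j. x i - x j))
       = (\<Sum>(i, j)\<in>{(i, j). i < j \<and> j < n \<and> R i j}. (x i - x j) * (y i - y j))"
proof -
  define f where "f = (\<lambda>(i, j). y i * (x i - x j))"
  let ?L = "{(i, j). i < j \<and> j < n \<and> R i j}" and ?U = "{(i, j). j < i \<and> i < n \<and> R i j}"
    and ?D = "{(i, j). i = j \<and> i < n \<and> R i j}"
  have fin: "finite ?L" "finite ?U" "finite ?D"
    by (rule finite_subset[of _ "{..<n} \<times> {..<n}"]; force)+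
  have "(\<Sum>i<n. y i * (\<Sum>j | j < n \<and> R i j. x i - x j))
      = sum f (SIGMA i:{..<n}. {j. j < n \<and> R i j})"
    by (simp add: sum.Sigma f_def sum_distrib_left)
  also have "(SIGMA i:{..<n}. {j. j < n \<and> R i j}) = (?L \<union> ?U) \<union> ?D"
    by auto
  also have "sum f ((?L \<union> ?U) \<union> ?D) = sum f (?L \<union> ?U) + sum f ?D"
    by (rule sum.union_disjoint) (use fin in auto)
  also have "sum f (?L \<union> ?U) = sum f ?L + sum f ?U"
    by (rule sum.union_disjoint) (use fin in auto)
  also have "sum f ?D = 0"
    by (rule sum.neutral) (auto simp: f_def)
  also have "sum f ?U = (\<Sum>(i, j)\<in>?L. y j * (x j - x i))"
    by (rule sum.reindex_bij_witness[of _ prod.swap prod.swap]) (auto simp: f_def sym)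
  finally show ?thesis
    by (simp add: f_def case_prod_unfold algebra_simps flip: sum.distrib)
qed

lemma laplacian_carrier [simp]: "laplacian lab \<in> carrier_mat 60 60"
  by (simp add: laplacian_def)

lemma laplacian_entry:
  assumes "i < 60" "j < 60"
  shows "laplacian lab $$ (i, j) =
    (if i = j then 3 else 0) - (if bucky_adj (lab i) (lab j) then 1 else 0)"
  using assms bucky_adj_sym[of "lab i" "lab j"] bucky_adj_sym[of "lab j" "lab i"] bucky_adj_irrefl
  by (auto simp: laplacian_def bucky_edges_def)

lemma laplacian_sym: "i < 60 \<Longrightarrow> j < 60 \<Longrightarrow> laplacian lab $$ (i, j) = laplacian lab $$ (j, i)"
  using bucky_adj_sym by (auto simp: laplacian_entry)

lemma labeled_nbrs:
  assumes "bucky_labeling lab" "i < 60"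
  shows "inj_on lab {j. j < 60 \<and> bucky_adj (lab i) (lab j)}"
    and "lab ` {j. j < 60 \<and> bucky_adj (lab i) (lab j)} = {q. bucky_adj (lab i) q}"
proof -
  have bij: "bij_betw lab {0..<60} bucky_vertices"
    using assms by (simp add: bucky_labeling_def)
  show "inj_on lab {j. j < 60 \<and> bucky_adj (lab i) (lab j)}"
    using bij_betw_imp_inj_on[OF bij] by (rule inj_on_subset) auto
  show "lab ` {j. j < 60 \<and> bucky_adj (lab i) (lab j)} = {q. bucky_adj (lab i) q}"
  proof (intro equalityI subsetI)
    fix q assume q: "q \<in> {q. bucky_adj (lab i) q}"
    then have "q \<in> lab ` {0..<60}"
      using bij_betw_imp_surj_on[OF bij] by (simp add: bucky_adj_def)
    with q show "q \<in> lab ` {j. j < 60 \<and> bucky_adj (lab i) (lab j)}" by auto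
  qed auto
qed

text \<open>The diagonal entry \<open>3\<close> is the number of neighbours, which allows the Laplacian to be written with
differences along edges.\<close>

lemma laplacian_apply:
  fixes x :: "nat \<Rightarrow> 'a :: real_field"
  assumes lab: "bucky_labeling lab" and i: "i < 60"
  shows "(\<Sum>j<60. of_real (laplacian lab $$ (i, j)) * x j)
       = (\<Sum>j | j < 60 \<and> bucky_adj (lab i) (lab j). x i - x j)"
proof -
  have "lab i \<in> bucky_vertices"
    using lab i by (auto simp: bucky_labeling_def bij_betw_def)
  then have card: "card {j. j < 60 \<and> bucky_adj (lab i) (lab j)} = 3"
    using card_image[OF labeled_nbrs(1)[OF lab i]] labeled_nbrs(2)[OF lab i] card_bucky_nbrs by simp
  have "(\<Sum>j<60. of_real (laplacian lab $$ (i, j)) * x j)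
      = (\<Sum>j<60. (if j = i then 3 * x i else 0) - (if bucky_adj (lab i) (lab j) then x j else 0))"
    using i by (intro sum.cong) (auto simp: laplacian_entry)
  also have "\<dots> = 3 * x i - (\<Sum>j | j < 60 \<and> bucky_adj (lab i) (lab j). x j)"
    using i by (simp add: sum_subtractf sum.If_cases) (simp add: Collect_conj_eq lessThan_def)
  also have "\<dots> = (\<Sum>j | j < 60 \<and> bucky_adj (lab i) (lab j). x i - x j)"
    by (simp add: sum_subtractf card)
  finally show ?thesis .
qed

lemma laplacian_form:
  fixes x y :: "nat \<Rightarrow> 'a :: real_field"
  assumes lab: "bucky_labeling lab"
  shows "(\<Sum>i<60. y i * (\<Sum>j<60. of_real (laplacian lab $$ (i, j)) * x j))
       = (\<Sum>(i, j)\<in>bucky_edges lab. (x i - x j) * (y i - y j))"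
  using dirichlet_form[where R = "\<lambda>i j. bucky_adj (lab i) (lab j)" and x = x and y = y and n = 60] bucky_adj_sym
  by (simp add: laplacian_apply[OF lab] bucky_edges_def)

section \<open>The pseudo Green matrix\<close>

text \<open>As for two-sided inverses: \<open>G = G * (A * H) = (G * A) * H = H\<close>, since \<open>A * H\<close> and \<open>G * A\<close> are the
projection away from the constants, which can be cancelled to the right of \<open>G\<close> and to the left
of \<open>H\<close>.\<close>

lemma pseudo_green_unique:
  assumes A: "A \<in> carrier_mat 60 60" and "is_pseudo_green A G" "is_pseudo_green A H"
  shows "G = H"
proof -
  have G: "G \<in> carrier_mat 60 60" "G * A = 1\<^sub>m 60 - E0_mat" "G * E0_mat = 0\<^sub>m 60 60"
    and H: "H \<in> carrier_mat 60 60" "A * H = 1\<^sub>m 60 - E0_mat" "E0_mat * H = 0\<^sub>m 60 60"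
    using assms by (auto simp: is_pseudo_green_def)
  have E: "E0_mat \<in> carrier_mat 60 60" by (simp add: E0_mat_def)
  have "G = G * 1\<^sub>m 60 - G * E0_mat"
    using G by (auto)
  also have "\<dots> = G * (A * H)"
    unfolding H(2) using G(1) E by (intro mult_minus_distrib_mat[symmetric]) auto
  also have "\<dots> = (G * A) * H"
    using A G(1) H(1) by simp
  also have "\<dots> = 1\<^sub>m 60 * H - E0_mat * H"
    unfolding G(2) using H(1) E by (intro minus_mult_distrib_mat) auto
  also have "\<dots> = H"
    using H by auto
  finally show ?thesis .
qed

text \<open>The Green columns, written into a matrix by means of the labeling, solve \<open>A * G = 1 - E\<close> with zero
column sums. The two equations from the other side follow by transposition, as soon as \<open>G\<close> is
known to be symmetric; and it is, because its entries are the values of the symmetric Dirichlet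
form on pairs of its columns.\<close>

lemma pseudo_green_exists:
  assumes lab: "bucky_labeling lab"
  shows "\<exists>G. is_pseudo_green (laplacian lab) G \<and> (\<forall>i<60. G $$ (i, i) = 239741 / 376200)"
proof -
  let ?A = "laplacian lab"
  have bij: "bij_betw lab {..<60} bucky_vertices"
    using lab by (simp add: bucky_labeling_def atLeast0LessThan)
  have labV: "lab i \<in> bucky_vertices" if "i < 60" for i
    using bij that by (auto simp: bij_betw_def)
  obtain h where h: "\<And>q. q \<in> bucky_vertices \<Longrightarrow> is_green_col q (h q)"
    using green_col_exists by metis
  define g where "g i j = h (lab j) (lab i)" for i j
  define G where "G = mat 60 60 (\<lambda>(i, j). g i j)"
  have Gc: "G \<in> carrier_mat 60 60" by (simp add: G_def)
  have diag: "g i i = 239741 / 376200" if "i < 60" for i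
    using h[OF labV[OF that]] by (simp add: g_def is_green_col_def)
  have colsum: "(\<Sum>i<60. g i j) = 0" if "j < 60" for j
    using h[OF labV[OF that]] sum.reindex_bij_betw[OF bij, of "h (lab j)"]
    by (simp add: g_def is_green_col_def)
  have Ag: "(\<Sum>k<60. ?A $$ (i, k) * g k j) = (if i = j then 1 else 0) - 1 / 60"
    if i: "i < 60" and j: "j < 60" for i j
  proof -
    have "(\<Sum>k<60. ?A $$ (i, k) * g k j) = (\<Sum>k | k < 60 \<and> bucky_adj (lab i) (lab k). g i j - g k j)"
      using laplacian_apply[OF lab i, of "\<lambda>k. g k j"] by simp
    also have "\<dots> = bucky_lap (h (lab j)) (lab i)"
      unfolding bucky_lap_def labeled_nbrs(2)[OF lab i, symmetric]
      using labeled_nbrs(1)[OF lab i] by (simp add: sum.reindex g_def)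
    also have "\<dots> = (if lab i = lab j then 1 else 0) - 1 / 60"
      using h[OF labV[OF j]] labV[OF i] by (simp add: is_green_col_def)
    also have "lab i = lab j \<longleftrightarrow> i = j"
      using bij_betw_imp_inj_on[OF bij] i j by (simp add: inj_on_eq_iff)
    finally show ?thesis .
  qed
  \<comment> \<open>The Gram matrix of the columns of \<open>G\<close> with respect to the Dirichlet form is \<open>G\<close> itself.\<close>
  have repr: "g k j = (\<Sum>(a, b)\<in>bucky_edges lab. (g a k - g b k) * (g a j - g b j))"
    if k: "k < 60" and j: "j < 60" for j k
  proof -
    have "(\<Sum>(a, b)\<in>bucky_edges lab. (g a k - g b k) * (g a j - g b j))
        = (\<Sum>i<60. g i j * (\<Sum>l<60. ?A $$ (i, l) * g l k))"
      using laplacian_form[OF lab, of "\<lambda>i. g i j" "\<lambda>i. g i k"] by simp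
    also have "\<dots> = (\<Sum>i<60. g i j * ((if i = k then 1 else 0) - 1 / 60))"
      using k by (simp add: Ag)
    also have "\<dots> = (\<Sum>i<60. (if i = k then g k j else 0) - g i j / 60)"
      by (intro sum.cong) (auto simp: algebra_simps)
    also have "\<dots> = g k j"
      using k colsum[OF j] by (simp add: sum_subtractf flip: sum_divide_distrib)
    finally show ?thesis by simp
  qed
  have gsym: "g k j = g j k" if "k < 60" "j < 60" for j k
    unfolding repr[OF that] repr[OF that(2,1)] by (simp add: mult.commute)
  have "?A * G = 1\<^sub>m 60 - E0_mat"
    using Ag by (intro eq_matI) (auto simp: G_def E0_mat_def scalar_prod_def atLeast0LessThan laplacian_def)
  moreover have "G * ?A = 1\<^sub>m 60 - E0_mat"
  proof (intro eq_matI)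
    fix i j assume "i < dim_row (1\<^sub>m 60 - E0_mat)" "j < dim_col (1\<^sub>m 60 - E0_mat)"
    then have ij: "i < 60" "j < 60" by (auto simp: E0_mat_def)
    have "(G * ?A) $$ (i, j) = (\<Sum>k<60. g i k * ?A $$ (k, j))"
      using ij carrier_matD[OF laplacian_carrier[of lab]]
      by (simp add: G_def scalar_prod_def atLeast0LessThan)
    also have "\<dots> = (\<Sum>k<60. ?A $$ (j, k) * g k i)"
      using ij by (intro sum.cong) (auto simp: gsym[of i] laplacian_sym[of j])
    finally show "(G * ?A) $$ (i, j) = (1\<^sub>m 60 - E0_mat) $$ (i, j)"
      using Ag[OF ij(2,1)] ij by (auto simp: E0_mat_def)
  qed (auto simp: G_def E0_mat_def laplacian_def)
  moreover have "E0_mat * G = 0\<^sub>m 60 60"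
    using colsum by (intro eq_matI)
      (auto simp: G_def E0_mat_def scalar_prod_def atLeast0LessThan simp flip: sum_divide_distrib)
  moreover have "G * E0_mat = 0\<^sub>m 60 60"
  proof (intro eq_matI)
    fix i j assume "i < dim_row (0\<^sub>m 60 60 :: real mat)" "j < dim_col (0\<^sub>m 60 60 :: real mat)"
    then have ij: "i < 60" "j < 60" by auto
    have "(G * E0_mat) $$ (i, j) = (\<Sum>k<60. g i k) / 60"
      using ij by (simp add: G_def E0_mat_def scalar_prod_def atLeast0LessThan sum_divide_distrib)
    also have "(\<Sum>k<60. g i k) = 0"
      using colsum[OF ij(1)] ij gsym[OF ij(1)] by simp
    finally show "(G * E0_mat) $$ (i, j) = 0\<^sub>m 60 60 $$ (i, j)"
      using ij by simp
  qed (auto simp: G_def E0_mat_def)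
  ultimately show ?thesis
    using Gc diag by (intro exI[of _ G]) (auto simp: is_pseudo_green_def G_def)
qed

lemma pseudo_green:
  assumes "bucky_labeling lab"
  shows "is_pseudo_green (laplacian lab) (pseudo_green (laplacian lab))"
    and "i < 60 \<Longrightarrow> pseudo_green (laplacian lab) $$ (i, i) = 239741 / 376200"
proof -
  obtain G where G: "is_pseudo_green (laplacian lab) G" "\<forall>i<60. G $$ (i, i) = 239741 / 376200"
    using pseudo_green_exists[OF assms] by blast
  then have "pseudo_green (laplacian lab) = G"
    unfolding pseudo_green_def
    using pseudo_green_unique[OF laplacian_carrier] by (intro the_equality) blast+
  with G show "is_pseudo_green (laplacian lab) (pseudo_green (laplacian lab))"
    and "i < 60 \<Longrightarrow> pseudo_green (laplacian lab) $$ (i, i) = 239741 / 376200" by auto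
qed

section \<open>The reproducing kernel and the Sobolev inequality\<close>

text \<open>On vectors with zero sum, the columns of the pseudo Green matrix form a reproducing kernel for the
Dirichlet form: by summation by parts the form pairs \<open>u\<close> with \<open>A\<close> applied to column \<open>k\<close>, which is
the unit vector at \<open>k\<close> minus a constant vector.\<close>

lemma green_reproducing:
  fixes u :: "nat \<Rightarrow> 'a :: real_field"
  assumes lab: "bucky_labeling lab" and G: "is_pseudo_green (laplacian lab) G"
    and sum0: "(\<Sum>i<60. u i) = 0" and k: "k < 60"
  shows "u k = (\<Sum>(i, j)\<in>bucky_edges lab. of_real (G $$ (i, k) - G $$ (j, k)) * (u i - u j))"
proof -
  have Gc: "G \<in> carrier_mat 60 60" and AG: "laplacian lab * G = 1\<^sub>m 60 - E0_mat"
    using G by (auto simp: is_pseudo_green_def)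
  have col: "(\<Sum>j<60. laplacian lab $$ (i, j) * G $$ (j, k)) = (if i = k then 1 else 0) - 1 / 60"
    if i: "i < 60" for i
  proof -
    have "(\<Sum>j<60. laplacian lab $$ (i, j) * G $$ (j, k)) = (laplacian lab * G) $$ (i, k)"
      using Gc i k carrier_matD[OF laplacian_carrier[of lab]]
      by (simp add: scalar_prod_def atLeast0LessThan)
    then show ?thesis
      unfolding AG using i k by (simp add: E0_mat_def)
  qed
  have "(\<Sum>(i, j)\<in>bucky_edges lab. of_real (G $$ (i, k) - G $$ (j, k)) * (u i - u j))
      = (\<Sum>i<60. u i * (\<Sum>j<60. of_real (laplacian lab $$ (i, j)) * of_real (G $$ (j, k))))"
    using laplacian_form[OF lab, of u "\<lambda>i. of_real (G $$ (i, k))"] by simp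
  also have "\<dots> = (\<Sum>i<60. u i * of_real (\<Sum>j<60. laplacian lab $$ (i, j) * G $$ (j, k)))"
    by simp
  also have "\<dots> = (\<Sum>i<60. u i * of_real ((if i = k then 1 else 0) - 1 / 60))"
    by (simp add: col del: of_real_sum of_real_mult)
  also have "\<dots> = (\<Sum>i<60. (if i = k then u k else 0) - u i / 60)"
    by (intro sum.cong) (auto simp: algebra_simps)
  also have "\<dots> = u k"
    using k sum0 by (simp add: sum_subtractf flip: sum_divide_distrib)
  finally show ?thesis by simp
qed

lemma green_colsum:
  assumes "is_pseudo_green A G" "k < 60"
  shows "(\<Sum>i<60. G $$ (i, k)) = 0"
proof -
  have Gc: "G \<in> carrier_mat 60 60" and EG: "E0_mat * G = 0\<^sub>m 60 60"
    using assms by (auto simp: is_pseudo_green_def)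
  have "(E0_mat * G) $$ (0, k) = (\<Sum>i<60. G $$ (i, k)) / 60"
    using Gc assms(2) by (simp add: E0_mat_def scalar_prod_def atLeast0LessThan sum_divide_distrib)
  then show ?thesis
    unfolding EG using assms(2) by simp
qed

lemma bucky_edges_less: "(i, j) \<in> bucky_edges lab \<Longrightarrow> i < 60 \<and> j < 60"
  by (auto simp: bucky_edges_def)

text \<open>The reproducing property, applied to column \<open>k\<close> itself.\<close>

lemma green_energy:
  assumes lab: "bucky_labeling lab" and G: "is_pseudo_green (laplacian lab) G" and k: "k < 60"
  shows "(\<Sum>(i, j)\<in>bucky_edges lab. (G $$ (i, k) - G $$ (j, k))\<^sup>2) = G $$ (k, k)"
  using green_reproducing[OF lab G green_colsum[OF G k] k] by (simp add: power2_eq_square)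

text \<open>The Cauchy--Schwarz inequality for the reproducing property; the energy of column \<open>k\<close> is the
diagonal entry.\<close>

lemma sobolev_pointwise:
  assumes lab: "bucky_labeling lab" and G: "is_pseudo_green (laplacian lab) G"
    and sum0: "(\<Sum>i<60. u $ i) = 0" and k: "k < 60"
  shows "(cmod (u $ k))\<^sup>2 \<le> G $$ (k, k) * sobolev_energy lab u"
proof -
  let ?E = "bucky_edges lab"
  let ?a = "\<lambda>(i, j). \<bar>G $$ (i, k) - G $$ (j, k)\<bar>" and ?b = "\<lambda>(i, j). cmod (u $ i - u $ j)"
  have "cmod (u $ k) \<le> (\<Sum>e\<in>?E. ?a e * ?b e)"
    unfolding green_reproducing[OF lab G sum0 k]
    by (rule order_trans[OF norm_sum]) (auto intro!: sum_mono simp: norm_mult simp del: of_real_diff)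
  then have "(cmod (u $ k))\<^sup>2 \<le> (\<Sum>e\<in>?E. ?a e * ?b e)\<^sup>2"
    by (intro power_mono) auto
  also have "\<dots> \<le> (\<Sum>e\<in>?E. (?a e)\<^sup>2) * (\<Sum>e\<in>?E. (?b e)\<^sup>2)"
    by (rule Cauchy_Schwarz_ineq_sum)
  also have "(\<Sum>e\<in>?E. (?a e)\<^sup>2) = G $$ (k, k)"
    using green_energy[OF lab G k] by (simp add: case_prod_unfold)
  also have "(\<Sum>e\<in>?E. (?b e)\<^sup>2) = sobolev_energy lab u"
    by (simp add: sobolev_energy_def case_prod_unfold)
  finally show ?thesis .
qed

lemma max_abs_attained: "\<exists>j<60. max_abs u = cmod (u $ j)"
proof -
  have "max_abs u \<in> (\<lambda>j. cmod (u $ j)) ` {0..<60}"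
    unfolding max_abs_def by (rule Max_in) auto
  then show ?thesis by auto
qed

lemma max_abs_ge: "j < 60 \<Longrightarrow> cmod (u $ j) \<le> max_abs u"
  unfolding max_abs_def by (rule Max_ge) auto

section \<open>The spectrum of the Laplacian\<close>

text \<open>For an eigenvector \<open>v\<close>, the Dirichlet form at \<open>v\<close> and its conjugate is the eigenvalue times the
squared norm of \<open>v\<close>, and it is also the energy of \<open>v\<close>. This shows at once that the eigenvalue is
real and that it is non-negative.\<close>

lemma laplacian_complex_eigenvalue:
  assumes lab: "bucky_labeling lab" and ev: "eigenvalue (map_mat complex_of_real (laplacian lab)) a"
  shows "\<exists>r\<ge>0. a = of_real r"
proof -
  let ?A = "map_mat complex_of_real (laplacian lab)"
  note dim = carrier_matD[OF laplacian_carrier[of lab]]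
  obtain v where v: "v \<in> carrier_vec 60" "v \<noteq> 0\<^sub>v 60" "?A *\<^sub>v v = a \<cdot>\<^sub>v v"
    using ev dim by (auto simp: eigenvalue_def eigenvector_def)
  have Av: "(\<Sum>j<60. of_real (laplacian lab $$ (i, j)) * v $ j) = a * v $ i" if "i < 60" for i
  proof -
    have "(?A *\<^sub>v v) $ i = (\<Sum>j<60. of_real (laplacian lab $$ (i, j)) * v $ j)"
      using that v(1) dim by (simp add: scalar_prod_def atLeast0LessThan)
    then show ?thesis
      unfolding v(3) using that v(1) by simp
  qed
  define N where "N = (\<Sum>i<60. (cmod (v $ i))\<^sup>2)"
  have "N \<noteq> 0"
  proof
    assume "N = 0"
    then have "\<forall>i<60. v $ i = 0"
      by (simp add: N_def sum_nonneg_eq_0_iff)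
    then have "v = 0\<^sub>v 60"
      using v(1) by (intro eq_vecI) auto
    with v(2) show False ..
  qed
  moreover have "N \<ge> 0" by (simp add: N_def sum_nonneg)
  ultimately have N: "N > 0" by simp
  have E: "sobolev_energy lab v \<ge> 0"
    by (simp add: sobolev_energy_def sum_nonneg case_prod_unfold)
  have "a * of_real N = (\<Sum>i<60. cnj (v $ i) * (a * v $ i))"
    unfolding N_def of_real_sum sum_distrib_left complex_norm_square by (simp add: mult_ac)
  also have "\<dots> = (\<Sum>i<60. cnj (v $ i) * (\<Sum>j<60. of_real (laplacian lab $$ (i, j)) * v $ j))"
    by (intro sum.cong refl) (simp only: Av lessThan_iff)
  also have "\<dots> = of_real (sobolev_energy lab v)"
    unfolding laplacian_form[OF lab] sobolev_energy_def of_real_sum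
    by (intro sum.cong) (auto simp: complex_norm_square simp flip: of_real_power complex_cnj_diff)
  finally have "a = of_real (sobolev_energy lab v / N)"
    using N by (simp add: field_simps)
  then show ?thesis
    using N E by (intro exI[of _ "sobolev_energy lab v / N"]) auto
qed

text \<open>Over the complex numbers the characteristic polynomial splits, and its roots, being real and
non-negative, already give a factorisation over the reals.\<close>

lemma laplacian_char_poly:
  assumes lab: "bucky_labeling lab"
  shows "\<exists>es. char_poly (laplacian lab) = (\<Prod>e\<leftarrow>es. [:- e, 1:]) \<and> length es = 60 \<and> (\<forall>e\<in>set es. 0 \<le> e)"
proof -
  let ?A = "map_mat complex_of_real (laplacian lab)"
  have Ac: "?A \<in> carrier_mat 60 60" by simp
  obtain as where as: "char_poly ?A = (\<Prod>a\<leftarrow>as. [:- a, 1:])" "length as = 60"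
    using char_poly_factorized[OF Ac] by blast
  have pos: "\<exists>r\<ge>0. a = complex_of_real r" if "a \<in> set as" for a
  proof -
    have "poly (char_poly ?A) a = 0"
      unfolding as(1) using that by (induction as) auto
    then show ?thesis
      using laplacian_complex_eigenvalue[OF lab] eigenvalue_root_char_poly[OF Ac] by blast
  qed
  define es where "es = map Re as"
  have as_es: "as = map complex_of_real es"
    unfolding es_def using pos by (simp add: o_def) (rule map_idI[symmetric], force)
  interpret p: map_poly_inj_idom_hom complex_of_real ..
  have "map_poly complex_of_real (char_poly (laplacian lab)) = (\<Prod>a\<leftarrow>as. [:- a, 1:])"
    using as(1) of_real_hom.char_poly_hom[OF laplacian_carrier] by metis
  also have "\<dots> = map_poly complex_of_real (\<Prod>e\<leftarrow>es. [:- e, 1:])"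
    unfolding as_es by (simp add: p.hom_prod_list o_def)
  finally have "char_poly (laplacian lab) = (\<Prod>e\<leftarrow>es. [:- e, 1:])"
    by (simp)
  moreover have "\<forall>e\<in>set es. 0 \<le> e"
    using pos by (force simp: es_def)
  ultimately show ?thesis
    using as(2) by (intro exI[of _ es]) (simp add: es_def)
qed

lemma proots_linear_factors: "proots (\<Prod>e\<leftarrow>es. [:- e, 1:]) = mset (es :: 'a :: idom list)"
proof (induction es)
  case (Cons e es)
  have "(\<Prod>e\<leftarrow>es. [:- e, 1:]) \<noteq> 0" by (auto simp: prod_list_zero_iff)
  then show ?case
    using Cons by (simp add: proots_mult del: mult_pCons_left)
qed simp

lemma prod_list_mset_cong:
  fixes f :: "'a \<Rightarrow> 'b :: comm_monoid_mult"
  assumes "mset xs = mset ys"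
  shows "(\<Prod>x\<leftarrow>xs. f x) = (\<Prod>x\<leftarrow>ys. f x)"
  using assms by (metis mset_map prod_mset_prod_list)

text \<open>The constants give the eigenvalue \<open>0\<close>, which comes first in the ordered list as no eigenvalue is
negative. That it is simple is part of lemma
\<open>trace_pseudo_inverse\<close>, which also sums the reciprocals of the rest of the list.\<close>

lemma laplacian_eigenvalue_list:
  assumes lab: "bucky_labeling lab"
  shows "\<exists>es. eigenvalue_list (laplacian lab) = 0 # es \<and> length es = 59 \<and> (\<forall>e\<in>set es. 0 < e) \<and>
    (\<Sum>e\<leftarrow>es. 1 / e) = (\<Sum>i<60. pseudo_green (laplacian lab) $$ (i, i))"
proof -
  let ?A = "laplacian lab" and ?G = "pseudo_green (laplacian lab)"
  note dim = carrier_matD[OF laplacian_carrier[of lab]]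
  obtain es0 where es0: "char_poly ?A = (\<Prod>e\<leftarrow>es0. [:- e, 1:])" "length es0 = 60" "\<forall>e\<in>set es0. 0 \<le> e"
    using laplacian_char_poly[OF lab] by blast
  have ls: "eigenvalue_list ?A = sort es0"
    unfolding eigenvalue_list_def es0(1) proots_linear_factors
    by (simp)
  have kern: "(\<Sum>j<60. ?A $$ (i, j)) = 0" if "i < 60" for i
    using laplacian_apply[OF lab that, of "\<lambda>_. 1 :: real"] by simp
  have "?A *\<^sub>v vec 60 (\<lambda>_. 1) = 0 \<cdot>\<^sub>v vec 60 (\<lambda>_. 1)"
    using kern dim by (intro eq_vecI) (auto simp: scalar_prod_def atLeast0LessThan)
  moreover have "vec 60 (\<lambda>_. 1 :: real) \<noteq> 0\<^sub>v 60"
    by (metis index_vec index_zero_vec(1) zero_less_numeral zero_neq_one)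
  ultimately have "eigenvalue ?A 0"
    using dim unfolding eigenvalue_def eigenvector_def by (intro exI[of _ "vec 60 (\<lambda>_. 1)"]) auto
  then have "poly (\<Prod>e\<leftarrow>es0. [:- e, 1:]) 0 = 0"
    using eigenvalue_root_char_poly[OF laplacian_carrier[of lab]] es0(1) by metis
  then have "0 \<in> set es0"
    by (induction es0) auto
  then obtain es where es: "sort es0 = 0 # es"
  proof -
    obtain e es where s: "sort es0 = e # es"
      using es0(2) by (metis length_0_conv length_sort list.exhaust zero_neq_numeral)
    have "0 \<in> set (e # es)" "\<forall>x\<in>set (e # es). 0 \<le> x" "sorted (e # es)"
      using \<open>0 \<in> set es0\<close> es0(3) by (simp_all flip: s)
    then have "e = 0" by auto
    with s that show thesis by blast
  qed
  have cp: "char_poly ?A = (\<Prod>e\<leftarrow>0 # es. [:- e, 1:])"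
    unfolding es0(1) by (rule prod_list_mset_cong) (simp flip: es)
  have G: "is_pseudo_green ?A ?G" by (rule pseudo_green(1)[OF lab])
  then have Gc: "?G \<in> carrier_mat 60 60" by (simp add: is_pseudo_green_def)
  have E: "E0_mat = mat 60 60 (\<lambda>_. 1 / real 60)" by (simp add: E0_mat_def)
  have EA: "E0_mat * ?A = 0\<^sub>m 60 60"
    using kern dim by (intro eq_matI)
      (auto simp: E0_mat_def scalar_prod_def atLeast0LessThan laplacian_sym[of _ _ lab] simp flip: sum_divide_distrib)
  note tr = trace_pseudo_inverse[OF E laplacian_carrier Gc _ EA _ cp]
  have "0 \<notin> set es" "(\<Sum>i<60. ?G $$ (i, i)) = (\<Sum>e\<leftarrow>es. 1 / e)"
    using tr G by (auto simp: is_pseudo_green_def)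
  moreover have "\<forall>e\<in>set es. 0 \<le> e" "length es = 59"
    using es0(2,3) arg_cong[OF es, of set] arg_cong[OF es, of length] by auto
  ultimately show ?thesis
    using ls es by (intro exI[of _ es]) (auto simp: less_le)
qed

section \<open>The best constant\<close>

theorem theorem3p1:
  fixes lab :: "nat \<Rightarrow> nat \<times> nat"
    and A G :: "real mat"
    and ev :: "nat \<Rightarrow> real"
  assumes lab: "bucky_labeling lab"
    and A: "A = laplacian lab"
    and G: "G = pseudo_green A"
    and ev: "ev = (\<lambda>j. eigenvalue_list A ! j)"
  shows "length (eigenvalue_list A) = 60 \<and> ev 0 = 0 \<and> 0 < ev 1 \<and>
    (\<exists>C>0. sobolev_inequality lab C) \<and>
    239741 / 376200 \<in> {C. 0 < C \<and> sobolev_inequality lab C} \<and>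
    (\<forall>C\<in>{C. 0 < C \<and> sobolev_inequality lab C}. 239741 / 376200 \<le> C) \<and>
    (\<forall>i<60. G $$ (i, i) = 239741 / 376200) \<and>
    239741 / 376200 = 1 / 60 * (\<Sum>j = 1..59. 1 / ev j) \<and>
    (\<forall>k<60. (max_abs (map_vec complex_of_real (col G k)))\<^sup>2 =
       239741 / 376200 * sobolev_energy lab (map_vec complex_of_real (col G k)))"
proof -
  define C0 :: real where "C0 = 239741 / 376200"
  have C0: "0 < C0" by (simp add: C0_def)
  have green: "is_pseudo_green (laplacian lab) G" and diag: "\<And>i. i < 60 \<Longrightarrow> G $$ (i, i) = C0"
    using pseudo_green[OF lab] by (simp_all add: G A C0_def)
  then have Gc: "G \<in> carrier_mat 60 60" by (simp add: is_pseudo_green_def)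
  have sob: "sobolev_inequality lab C0"
    unfolding sobolev_inequality_def
  proof (intro ballI impI)
    fix u :: "complex vec" assume "(\<Sum>j = 0..<60. u $ j) = 0"
    then have u: "(\<Sum>j<60. u $ j) = 0" by (simp add: atLeast0LessThan)
    obtain k where "k < 60" "max_abs u = cmod (u $ k)"
      using max_abs_attained by blast
    then show "(max_abs u)\<^sup>2 \<le> C0 * sobolev_energy lab u"
      using sobolev_pointwise[OF lab green u] diag by simp
  qed
  define c where "c k = map_vec complex_of_real (col G k)" for k
  have ck: "c k $ i = complex_of_real (G $$ (i, k))" if "i < 60" "k < 60" for i k
    using that Gc by (simp add: c_def)
  have c_sum: "(\<Sum>j = 0..<60. c k $ j) = 0" and c_carrier: "c k \<in> carrier_vec 60" if "k < 60" for k
    using green_colsum[OF green that] that Gc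
    by (simp_all add: ck atLeast0LessThan c_def flip: of_real_sum)
  have c_energy: "sobolev_energy lab (c k) = C0" if k: "k < 60" for k
  proof -
    have "sobolev_energy lab (c k) = (\<Sum>(i, j)\<in>bucky_edges lab. (G $$ (i, k) - G $$ (j, k))\<^sup>2)"
      unfolding sobolev_energy_def
      using bucky_edges_less k by (intro sum.cong) (fastforce simp: ck simp flip: of_real_diff)+
    then show ?thesis
      using green_energy[OF lab green k] diag[OF k] by simp
  qed
  have c_max: "C0\<^sup>2 \<le> (max_abs (c k))\<^sup>2" if "k < 60" for k
    using max_abs_ge[OF that, of "c k"] C0 that by (intro power_mono) (auto simp: ck diag)
  \<comment> \<open>Column \<open>0\<close> has energy \<open>C0\<close>, but attains the value \<open>C0\<close> at its source.\<close>
  have best: "C0 \<le> C" if "sobolev_inequality lab C" for C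
  proof -
    have "C0\<^sup>2 \<le> C * C0"
      using that c_max[of 0] c_sum[of 0] c_carrier[of 0] c_energy[of 0]
      by (force simp: sobolev_inequality_def)
    then show ?thesis
      using C0 by (simp add: power2_eq_square)
  qed
  have extremal: "(max_abs (c k))\<^sup>2 = C0 * sobolev_energy lab (c k)" if k: "k < 60" for k
  proof (rule antisym)
    show "(max_abs (c k))\<^sup>2 \<le> C0 * sobolev_energy lab (c k)"
      using sob c_sum[OF k] c_carrier[OF k] by (simp add: sobolev_inequality_def)
    show "C0 * sobolev_energy lab (c k) \<le> (max_abs (c k))\<^sup>2"
      using c_max[OF k] by (simp add: c_energy[OF k] power2_eq_square)
  qed
  obtain es where es: "eigenvalue_list A = 0 # es" "length es = 59" "\<forall>e\<in>set es. 0 < e"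
      "(\<Sum>e\<leftarrow>es. 1 / e) = (\<Sum>i<60. G $$ (i, i))"
    using laplacian_eigenvalue_list[OF lab] by (auto simp: A G)
  have "(\<Sum>j = 1..59. 1 / ev j) = (\<Sum>j = 0..<59. 1 / es ! j)"
    by (rule sum.reindex_bij_witness[of _ Suc "\<lambda>j. j - 1"]) (auto simp: ev es(1))
  also have "\<dots> = (\<Sum>e\<leftarrow>es. 1 / e)"
    by (simp add: sum_list_sum_nth es(2))
  also have "\<dots> = 60 * C0"
    by (simp add: es(4) diag)
  finally have trace: "C0 = 1 / 60 * (\<Sum>j = 1..59. 1 / ev j)" by simp
  have "length (eigenvalue_list A) = 60" "ev 0 = 0" "0 < ev 1"
    using es by (auto simp: ev)
  then show ?thesis
    unfolding C0_def[symmetric] c_def[symmetric]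
    using C0 sob best diag trace extremal by blast
qed

end
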